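(* Let $d^{(1)}_{n,4}$ be the number of permutations $\sigma\in S_n$ that have no $1324$-match and satisfy $\mathrm{des}(\sigma)=1$. Then, as formal power series, $$\sum_{n\ge 0}d^{(1)}_{n,4}\frac{t^n}{n!}=e^{2t}-(2t-2)e^t-3-2t-\frac{t^2}{2}.$$ Consequently, for all $n\ge 4$, $d^{(1)}_{n,4}=2^n-2n+2$.
   Context: For a sequence of distinct integers, $\mathrm{red}$ denotes the permutation obtained by replacing the $i$-th smallest integer of the sequence by $i$. A permutation $\sigma=\sigma_1\cdots\sigma_n\in S_n$ has a $1324$-match if $\mathrm{red}(\sigma_i\sigma_{i+1}\sigma_{i+2}\sigma_{i+3})=1\,3\,2\,4$ for some $i$ (consecutive positions). $\mathrm{des}(\sigma)=|\{i:\sigma_i>\sigma_{i+1}\}|$. *)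

theory Defs
  imports "HOL-Combinatorics.Multiset_Permutations" "HOL-Computational_Algebra.Formal_Power_Series"
begin

text \<open>
  Permutations in \<open>S\<^sub>n\<close> are written in one-line notation, as the distinct lists with set \<open>{1..n}\<close>,
  i.e. the elements of \<^term>\<open>permutations_of_set {1..n}\<close>. List positions start at 0.
\<close>

definition red :: "'a::linorder list \<Rightarrow> nat list" where
  "red xs = map (\<lambda>x. card {y \<in> set xs. y \<le> x}) xs"

definition has_match :: "nat list \<Rightarrow> 'a::linorder list \<Rightarrow> bool" where
  "has_match \<tau> \<sigma> \<longleftrightarrow>
     (\<exists>i. i + length \<tau> \<le> length \<sigma> \<and> red (take (length \<tau>) (drop i \<sigma>)) = \<tau>)"

definition des :: "'a::linorder list \<Rightarrow> nat" where
  "des \<sigma> = card {i. i + 1 < length \<sigma> \<and> \<sigma> ! i > \<sigma> ! (i + 1)}"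

definition d1_4 :: "nat \<Rightarrow> nat" where
  "d1_4 n = card {\<sigma> \<in> permutations_of_set {1..n}. \<not> has_match [1, 3, 2, 4] \<sigma> \<and> des \<sigma> = 1}"

end

theory Submission
  imports Defs
begin

text \<open>
  A permutation of an \<open>n\<close>-element set with at most one descent is the concatenation of two increasing
  runs, hence is given by the set \<open>S\<close> of entries of its first run. If \<open>S\<close> is one of the \<open>n + 1\<close>
  initial segments, the concatenation has no descent; each of the other \<open>2\<^sup>n - (n + 1)\<close> subsets yields
  exactly one permutation with a single descent, and \<open>S\<close> can be read off from the position of the
  descent (\<open>card_one_descent\<close>).

  If such a permutation \<open>\<sigma>\<close> has a \<open>1324\<close>-match, the descent \<open>3 > 2\<close> of the match is the only
  descent of \<open>\<sigma>\<close>. Exchanging these two entries removes it, and the inequalities \<open>1 < 2\<close> and \<open>3 < 4\<close>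
  of the pattern guarantee that the exchange creates no new one. So \<open>\<sigma>\<close> is the increasing arrangement
  with two adjacent entries exchanged. There must be one entry before this pair and one after it,
  which leaves \<open>n - 3\<close> positions (\<open>card_one_descent_match\<close>).

  The difference is \<open>2\<^sup>n - 2n + 2\<close> for \<open>n \<ge> 3\<close>. The series identity is this count compared
  coefficientwise, where the subtracted polynomial \<open>3 + 2t + t\<^sup>2/2\<close> corrects the terms with \<open>n \<le> 2\<close>.
\<close>

section \<open>Descents\<close>

definition descents :: "'a::linorder list \<Rightarrow> nat set" where
  "descents xs = {i. Suc i < length xs \<and> xs ! i > xs ! Suc i}"

lemma des_eq_card_descents: "des xs = card (descents xs)"
  by (simp add: des_def descents_def)

lemma des_eq_1_iff: "des xs = 1 \<longleftrightarrow> (\<exists>i. descents xs = {i})"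
  by (simp add: des_eq_card_descents card_1_singleton_iff)

lemma sorted_iff_descents_empty: "sorted xs \<longleftrightarrow> descents xs = {}"
  by (auto simp: sorted_iff_nth_Suc descents_def not_less[symmetric])

lemma descents_append_sorted:
  assumes "sorted xs" "sorted ys" "i \<in> descents (xs @ ys)"
  shows "Suc i = length xs"
proof (rule ccontr)
  assume neq: "Suc i \<noteq> length xs"
  have i: "Suc i < length xs + length ys" "(xs @ ys) ! i > (xs @ ys) ! Suc i"
    using assms(3) by (auto simp: descents_def)
  show False
  proof (cases "Suc i < length xs")
    case True
    then show False
      using i assms(1) by (auto simp: nth_append sorted_iff_nth_Suc not_less[symmetric])
  next
    case False
    with neq have "length xs \<le> i" by simp
    then show False
      using i assms(2) by (auto simp: nth_append sorted_iff_nth_Suc Suc_diff_le not_less[symmetric])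
  qed
qed

lemma runs_of_one_descent:
  assumes "descents xs = {i}"
  shows "sorted (take (Suc i) xs)" "sorted (drop (Suc i) xs)"
proof -
  have le: "xs ! j \<le> xs ! Suc j" if "j \<noteq> i" "Suc j < length xs" for j
    using assms that by (auto simp: descents_def not_less[symmetric])
  show "sorted (take (Suc i) xs)" "sorted (drop (Suc i) xs)"
    by (auto simp: sorted_iff_nth_Suc intro!: le)
qed

lemma permutation_sorted_iff:
  assumes "finite A" "xs \<in> permutations_of_set A"
  shows "sorted xs \<longleftrightarrow> xs = sorted_list_of_set A"
  using assms sorted_distinct_set_unique[of xs "sorted_list_of_set A"]
    sorted_sorted_list_of_set[of A]
  by (metis distinct_sorted_list_of_set permutations_of_setD set_sorted_list_of_set)

section \<open>Permutations with one descent\<close>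

definition two_runs :: "'a::linorder set \<Rightarrow> 'a set \<Rightarrow> 'a list" where
  "two_runs A S = sorted_list_of_set S @ sorted_list_of_set (A - S)"

definition initial_segments :: "'a::linorder set \<Rightarrow> 'a set set" where
  "initial_segments A = (\<lambda>k. set (take k (sorted_list_of_set A))) ` {..card A}"

lemma two_runs_permutation:
  assumes "finite A" "S \<subseteq> A"
  shows "two_runs A S \<in> permutations_of_set A"
  using assms finite_subset[OF assms(2,1)] by (auto simp: permutations_of_set_def two_runs_def)

lemma two_runs_cancel:
  assumes "finite A" "S \<subseteq> A" "T \<subseteq> A" "card S = card T" "two_runs A S = two_runs A T"
  shows "S = T"
proof -
  have fin: "finite S" "finite T" using assms finite_subset by auto
  have "sorted_list_of_set S = sorted_list_of_set T"
    using assms(4,5) by (simp add: two_runs_def append_eq_append_conv)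
  then show ?thesis using fin by (metis sorted_list_of_set.set_sorted_key_list_of_set)
qed

lemma take_sorted_list_of_set:
  fixes A :: "'a::linorder set"
  assumes "finite A" "k \<le> card A"
  shows "card (set (take k (sorted_list_of_set A))) = k"
  using assms by (simp add: distinct_card)

lemma card_initial_segments:
  assumes "finite A"
  shows "card (initial_segments A) = card A + 1"
proof -
  have "inj_on (\<lambda>k. set (take k (sorted_list_of_set A))) {..card A}"
    by (rule inj_onI) (metis assms atMost_iff take_sorted_list_of_set)
  then show ?thesis by (simp add: initial_segments_def card_image)
qed

lemma initial_segments_subset:
  assumes "finite A"
  shows "initial_segments A \<subseteq> Pow A"
  using assms by (auto simp: initial_segments_def dest!: in_set_takeD)

lemma sorted_two_runs_iff:
  assumes "finite A" "S \<subseteq> A"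
  shows "sorted (two_runs A S) \<longleftrightarrow> S \<in> initial_segments A"
proof
  have fin: "finite S" using assms finite_subset by auto
  assume "sorted (two_runs A S)"
  then have "two_runs A S = sorted_list_of_set A"
    using permutation_sorted_iff two_runs_permutation assms by blast
  then have "take (card S) (sorted_list_of_set A) = sorted_list_of_set S"
    by (metis two_runs_def append_eq_conv_conj sorted_list_of_set.length_sorted_key_list_of_set)
  then have "S = set (take (card S) (sorted_list_of_set A))" using fin by simp
  then show "S \<in> initial_segments A"
    using card_mono[OF assms] by (auto simp: initial_segments_def)
next
  assume "S \<in> initial_segments A"
  then obtain k where S: "S = set (take k (sorted_list_of_set A))"
    by (auto simp: initial_segments_def)
  define L where "L = sorted_list_of_set A"
  have L: "sorted L" "distinct L" "set L = A" using assms by (auto simp: L_def)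
  have "A - S = set (drop k L)"
    using L set_take_disj_set_drop_if_distinct[of L k k] S L_def
    by (metis Diff_cancel Diff_triv Int_commute Un_Diff append_take_drop_id order_refl set_append Un_empty_left)
  moreover have "sorted_list_of_set (set (take k L)) = take k L"
    "sorted_list_of_set (set (drop k L)) = drop k L"
    using L by (auto simp: sorted_wrt_take sorted_wrt_drop intro!: sorted_list_of_set.idem_if_sorted_distinct)
  ultimately have "two_runs A S = L" using S L_def by (simp add: two_runs_def)
  then show "sorted (two_runs A S)" using L by simp
qed

text \<open>
  Off the initial segments there is a descent, and it must occur where the two runs meet. This is
  what makes \<open>two_runs A\<close> injective there: equal permutations have equal first-run lengths.
\<close>
lemma descents_two_runs:
  assumes "finite A" "S \<in> Pow A - initial_segments A"
  shows "descents (two_runs A S) = {card S - 1}" "card S > 0"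
proof -
  have fin: "finite S" using assms finite_subset by auto
  have *: "Suc i = card S" if "i \<in> descents (two_runs A S)" for i
    using descents_append_sorted[OF _ _ that[unfolded two_runs_def]] by simp
  have "descents (two_runs A S) \<noteq> {}"
    using assms sorted_two_runs_iff sorted_iff_descents_empty by blast
  then obtain i where i: "i \<in> descents (two_runs A S)" by blast
  then show "card S > 0" using * by force
  have "x = card S - 1" if "x \<in> descents (two_runs A S)" for x
    using *[OF that] by simp
  then show "descents (two_runs A S) = {card S - 1}" using i by blast
qed

lemma two_runs_bij_betw:
  assumes "finite A"
  shows "bij_betw (two_runs A) (Pow A - initial_segments A)
           {\<sigma> \<in> permutations_of_set A. des \<sigma> = 1}"
proof (rule bij_betw_imageI)
  show "inj_on (two_runs A) (Pow A - initial_segments A)"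
  proof (rule inj_onI)
    fix S T
    assume *: "S \<in> Pow A - initial_segments A" "T \<in> Pow A - initial_segments A"
      "two_runs A S = two_runs A T"
    then have "card S = card T"
      using descents_two_runs[OF assms *(1)] descents_two_runs[OF assms *(2)] by simp
    then show "S = T" using * assms two_runs_cancel by blast
  qed
  show "two_runs A ` (Pow A - initial_segments A) = {\<sigma> \<in> permutations_of_set A. des \<sigma> = 1}"
  proof (intro equalityI subsetI)
    fix \<sigma> assume "\<sigma> \<in> two_runs A ` (Pow A - initial_segments A)"
    then show "\<sigma> \<in> {\<sigma> \<in> permutations_of_set A. des \<sigma> = 1}"
      using assms two_runs_permutation by (auto simp: des_eq_card_descents descents_two_runs)
  next
    fix \<sigma> assume "\<sigma> \<in> {\<sigma> \<in> permutations_of_set A. des \<sigma> = 1}"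
    then obtain i where i: "descents \<sigma> = {i}" and \<sigma>: "set \<sigma> = A" "distinct \<sigma>"
      unfolding mem_Collect_eq des_eq_1_iff permutations_of_set_def by blast
    define S where "S = set (take (Suc i) \<sigma>)"
    have sub: "S \<subseteq> A" unfolding S_def using \<sigma> set_take_subset by metis
    have "A - S = set (drop (Suc i) \<sigma>)"
      using \<sigma> set_take_disj_set_drop_if_distinct[of \<sigma> "Suc i" "Suc i"] unfolding S_def
      by (metis Diff_cancel Diff_triv Int_commute Un_Diff append_take_drop_id order_refl set_append Un_empty_left)
    then have eq: "two_runs A S = \<sigma>"
      using runs_of_one_descent[OF i] \<sigma>(2)
      by (simp add: two_runs_def S_def sorted_list_of_set.idem_if_sorted_distinct)
    moreover have "S \<notin> initial_segments A"
      using sorted_two_runs_iff[OF assms sub] i eq by (simp add: sorted_iff_descents_empty)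
    ultimately show "\<sigma> \<in> two_runs A ` (Pow A - initial_segments A)" using sub by blast
  qed
qed

lemma card_one_descent:
  assumes "finite A"
  shows "card {\<sigma> \<in> permutations_of_set A. des \<sigma> = 1} = 2 ^ card A - (card A + 1)"
proof -
  have "card {\<sigma> \<in> permutations_of_set A. des \<sigma> = 1} = card (Pow A - initial_segments A)"
    using bij_betw_same_card[OF two_runs_bij_betw[OF assms]] by simp
  also have "\<dots> = 2 ^ card A - (card A + 1)"
    using initial_segments_subset[OF assms] assms
    by (subst card_Diff_subset) (auto simp: card_initial_segments card_Pow intro: finite_subset)
  finally show ?thesis .
qed

section \<open>Matches of 1324\<close>

text \<open>
  Ranks determine the order of the entries even if entries may coincide, since the rank is monotone
  in the entry: a strictly smaller rank forces a strictly smaller entry.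
\<close>
lemma red_1324_iff: "red [a, b, c, d] = [1, 3, 2, 4] \<longleftrightarrow> a < c \<and> c < b \<and> b < d"
proof
  define r where "r x = card {y \<in> {a, b, c, d}. y \<le> x}" for x
  have mono: "r x \<le> r y" if "x \<le> y" for x y
    unfolding r_def using that by (intro card_mono) auto
  have less: "x < y" if "r x < r y" for x y
    using mono[of y x] that by (meson not_less)
  assume "red [a, b, c, d] = [1, 3, 2, 4]"
  then have "r a = 1" "r b = 3" "r c = 2" "r d = 4"
    unfolding red_def r_def by auto
  then show "a < c \<and> c < b \<and> b < d" by (intro conjI less) simp_all
next
  assume *: "a < c \<and> c < b \<and> b < d"
  have "{y \<in> {a, b, c, d}. y \<le> a} = {a}" "{y \<in> {a, b, c, d}. y \<le> b} = {a, c, b}"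
    "{y \<in> {a, b, c, d}. y \<le> c} = {a, c}" "{y \<in> {a, b, c, d}. y \<le> d} = {a, c, b, d}"
    using * by auto
  moreover have "distinct [a, c, b, d]" using * by auto
  ultimately show "red [a, b, c, d] = [1, 3, 2, 4]"
    by (simp add: red_def)
qed

lemma has_match_1324_iff:
  "has_match [1, 3, 2, 4] xs \<longleftrightarrow> (\<exists>j. j + 3 < length xs \<and>
     xs ! j < xs ! (j + 2) \<and> xs ! (j + 2) < xs ! (j + 1) \<and> xs ! (j + 1) < xs ! (j + 3))"
proof -
  have "take 4 (drop j xs) = [xs ! j, xs ! (j + 1), xs ! (j + 2), xs ! (j + 3)]"
    if "j + 3 < length xs" for j
    using that by (intro nth_equalityI) (auto simp: less_Suc_eq numeral_eq_Suc)
  then have "(j + 4 \<le> length xs \<and> red (take 4 (drop j xs)) = [1, 3, 2, 4]) \<longleftrightarrow>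
      (j + 3 < length xs \<and> xs ! j < xs ! (j + 2) \<and> xs ! (j + 2) < xs ! (j + 1) \<and>
       xs ! (j + 1) < xs ! (j + 3))" for j
    by (cases "j + 3 < length xs") (simp_all only: red_1324_iff, simp_all)
  moreover have "length [1, 3, 2, 4 :: nat] = 4" by simp
  ultimately show ?thesis unfolding has_match_def by metis
qed

definition adjacent_swap :: "nat \<Rightarrow> 'a list \<Rightarrow> 'a list" where
  "adjacent_swap i xs = xs[i := xs ! Suc i, Suc i := xs ! i]"

lemma length_adjacent_swap [simp]: "length (adjacent_swap i xs) = length xs"
  by (simp add: adjacent_swap_def)

lemma nth_adjacent_swap:
  assumes "Suc i < length xs"
  shows "adjacent_swap i xs ! k = xs ! (if k = i then Suc i else if k = Suc i then i else k)"
  using assms by (auto simp: adjacent_swap_def nth_list_update)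

lemma adjacent_swap_involution:
  assumes "Suc i < length xs"
  shows "adjacent_swap i (adjacent_swap i xs) = xs"
  using assms by (intro nth_equalityI) (auto simp: nth_adjacent_swap)

lemma adjacent_swap_permutation:
  assumes "xs \<in> permutations_of_set A" "Suc i < length xs"
  shows "adjacent_swap i xs \<in> permutations_of_set A"
proof -
  have "mset (adjacent_swap i xs) = mset xs"
    using assms(2) by (simp add: adjacent_swap_def mset_swap)
  then show ?thesis
    using assms(1) by (metis (no_types, lifting) mem_Collect_eq permutations_of_set_def
        mset_eq_setD mset_eq_imp_distinct_iff)
qed

lemma descents_adjacent_swap_sorted:
  assumes "sorted xs" "distinct xs" "Suc i < length xs"
  shows "descents (adjacent_swap i xs) = {i}"
proof -
  have less: "xs ! j < xs ! k" if "j < k" "k < length xs" for j k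
    using assms(1,2) that by (simp add: sorted_wrt_nth_less strict_sorted_iff)
  show ?thesis
  proof (intro equalityI subsetI)
    fix k assume k: "k \<in> descents (adjacent_swap i xs)"
    consider "k = i" | "Suc k = i" | "k = Suc i" | "k \<notin> {i, Suc i}" "Suc k \<noteq> i" by blast
    then show "k \<in> {i}"
      using k assms(3) less[of k "Suc i"] less[of i "Suc k"] less[of k "Suc k"]
      by cases (auto simp: descents_def nth_adjacent_swap)
  next
    fix k assume "k \<in> {i}"
    then show "k \<in> descents (adjacent_swap i xs)"
      using assms(3) less by (auto simp: descents_def nth_adjacent_swap)
  qed
qed

text \<open>
  The outer inequalities of the pattern are what keeps the list sorted next to the exchanged pair.
\<close>
lemma sorted_adjacent_swap_match:
  assumes desc: "descents xs = {Suc j}" and j: "j + 3 < length xs"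
    and less: "xs ! j < xs ! (j + 2)" "xs ! (j + 1) < xs ! (j + 3)"
  shows "sorted (adjacent_swap (Suc j) xs)"
  unfolding sorted_iff_nth_Suc
proof (intro allI impI)
  fix k assume k: "Suc k < length (adjacent_swap (Suc j) xs)"
  have le: "xs ! l \<le> xs ! Suc l" if "l \<noteq> Suc j" "Suc l < length xs" for l
    using desc that by (auto simp: descents_def not_less[symmetric])
  have gt: "xs ! Suc (Suc j) < xs ! Suc j"
    using desc by (auto simp: descents_def)
  consider "k = j" | "k = Suc j" | "k = j + 2" | "k \<notin> {j, Suc j, j + 2}" by blast
  then show "adjacent_swap (Suc j) xs ! k \<le> adjacent_swap (Suc j) xs ! Suc k"
    using k j less gt le[of k] by cases (auto simp: nth_adjacent_swap numeral_eq_Suc)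
qed

lemma one_descent_match_eq_swaps:
  fixes A :: "'a::linorder set"
  assumes "finite A"
  shows "{\<sigma> \<in> permutations_of_set A. has_match [1, 3, 2, 4] \<sigma> \<and> des \<sigma> = 1} =
    (\<lambda>j. adjacent_swap (Suc j) (sorted_list_of_set A)) ` {..<card A - 3}"
proof (intro equalityI subsetI)
  fix \<sigma> assume "\<sigma> \<in> {\<sigma> \<in> permutations_of_set A. has_match [1, 3, 2, 4] \<sigma> \<and> des \<sigma> = 1}"
  then obtain i j where \<sigma>: "\<sigma> \<in> permutations_of_set A" and i: "descents \<sigma> = {i}"
    and j: "j + 3 < length \<sigma>" "\<sigma> ! j < \<sigma> ! (j + 2)" "\<sigma> ! (j + 2) < \<sigma> ! (j + 1)"
      "\<sigma> ! (j + 1) < \<sigma> ! (j + 3)"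
    unfolding mem_Collect_eq des_eq_1_iff has_match_1324_iff by blast
  have "Suc j \<in> descents \<sigma>" using j by (simp add: descents_def)
  then have desc: "descents \<sigma> = {Suc j}" using i by auto
  have len: "length \<sigma> = card A"
    using \<sigma> by (auto simp: permutations_of_set_def distinct_card)
  have "sorted (adjacent_swap (Suc j) \<sigma>)"
    using desc j by (intro sorted_adjacent_swap_match)
  then have "adjacent_swap (Suc j) \<sigma> = sorted_list_of_set A"
    using permutation_sorted_iff[OF assms adjacent_swap_permutation[OF \<sigma>]] j by simp
  then have "\<sigma> = adjacent_swap (Suc j) (sorted_list_of_set A)"
    using adjacent_swap_involution[of "Suc j" \<sigma>] j by simp
  then show "\<sigma> \<in> (\<lambda>j. adjacent_swap (Suc j) (sorted_list_of_set A)) ` {..<card A - 3}"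
    using j len by auto
next
  define L where "L = sorted_list_of_set A"
  have L: "sorted L" "distinct L" "L \<in> permutations_of_set A" "length L = card A"
    using assms by (auto simp: L_def permutations_of_set_def)
  have less: "L ! j < L ! k" if "j < k" "k < length L" for j k
    using L(1,2) that by (simp add: sorted_wrt_nth_less strict_sorted_iff)
  fix \<sigma> assume "\<sigma> \<in> (\<lambda>j. adjacent_swap (Suc j) (sorted_list_of_set A)) ` {..<card A - 3}"
  then obtain j where "j \<in> {..<card A - 3}" and \<sigma>: "\<sigma> = adjacent_swap (Suc j) L"
    unfolding L_def by (rule imageE)
  then have j: "j + 3 < length L" using L(4) by simp
  have "has_match [1, 3, 2, 4] \<sigma>"
    unfolding has_match_1324_iff \<sigma> using j less
    by (intro exI[of _ j]) (auto simp: nth_adjacent_swap)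
  moreover have "des \<sigma> = 1"
    using descents_adjacent_swap_sorted[OF L(1,2)] j \<sigma> by (simp add: des_eq_card_descents)
  moreover have "\<sigma> \<in> permutations_of_set A"
    using adjacent_swap_permutation[OF L(3)] j \<sigma> by simp
  ultimately show "\<sigma> \<in> {\<sigma> \<in> permutations_of_set A. has_match [1, 3, 2, 4] \<sigma> \<and> des \<sigma> = 1}"
    by simp
qed

lemma card_one_descent_match:
  fixes A :: "'a::linorder set"
  assumes "finite A"
  shows "card {\<sigma> \<in> permutations_of_set A. has_match [1, 3, 2, 4] \<sigma> \<and> des \<sigma> = 1} = card A - 3"
proof -
  have "inj_on (\<lambda>j. adjacent_swap (Suc j) (sorted_list_of_set A)) {..<card A - 3}"
  proof (rule inj_onI)
    fix j k
    assume *: "j \<in> {..<card A - 3}" "k \<in> {..<card A - 3}"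
      "adjacent_swap (Suc j) (sorted_list_of_set A) = adjacent_swap (Suc k) (sorted_list_of_set A)"
    have "descents (adjacent_swap (Suc l) (sorted_list_of_set A)) = {Suc l}"
      if "l \<in> {..<card A - 3}" for l
      by (rule descents_adjacent_swap_sorted) (use that assms in simp_all)
    from this[OF *(1)] this[OF *(2)] show "j = k" unfolding *(3) by simp
  qed
  then show ?thesis unfolding one_descent_match_eq_swaps[OF assms] by (simp add: card_image)
qed

section \<open>The count and its generating function\<close>

text \<open>
  Both subtractions are truncated, and the formula is right for every \<open>n\<close>: always \<open>n + 1 \<le> 2\<^sup>n\<close>,
  and lists with fewer than four entries have no match.
\<close>
lemma d1_4_eq: "d1_4 n = 2 ^ n - (n + 1) - (n - 3)"
proof -
  let ?P = "permutations_of_set {1..n}"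
  have "{\<sigma> \<in> ?P. \<not> has_match [1, 3, 2, 4] \<sigma> \<and> des \<sigma> = 1} =
      {\<sigma> \<in> ?P. des \<sigma> = 1} - {\<sigma> \<in> ?P. has_match [1, 3, 2, 4] \<sigma> \<and> des \<sigma> = 1}"
    by blast
  then have "d1_4 n = card {\<sigma> \<in> ?P. des \<sigma> = 1} -
      card {\<sigma> \<in> ?P. has_match [1, 3, 2, 4] \<sigma> \<and> des \<sigma> = 1}"
    unfolding d1_4_def by (subst card_Diff_subset[symmetric]) auto
  then show ?thesis
    using card_one_descent[of "{1..n}"] card_one_descent_match[of "{1..n}"] by simp
qed

lemma d1_4_eq_int:
  assumes "n \<ge> 3"
  shows "int (d1_4 n) = 2 ^ n - 2 * int n + 2"
proof -
  have "2 * n \<le> 2 ^ n" using assms by (induction n rule: dec_induct) auto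
  then have "d1_4 n + 2 * n = 2 ^ n + 2"
    using assms by (simp add: d1_4_eq)
  then have "int (d1_4 n + 2 * n) = int (2 ^ n + 2)" by (rule arg_cong)
  then show ?thesis by simp
qed

lemma fps_rhs_nth:
  "fps_nth (fps_exp 2 - (2 * fps_X - 2) * fps_exp 1 - 3 - 2 * fps_X - fps_const (1/2) * fps_X ^ 2 :: rat fps) n
   = (2 ^ n - 2 * of_nat n + 2) / fact n
     - (if n = 0 then 3 else if n = 1 then 2 else if n = 2 then 1 / 2 else 0)"
proof -
  have *: "(2 * fps_X - 2) * fps_exp 1 = fps_const 2 * (fps_X * fps_exp 1) - fps_const 2 * fps_exp (1::rat)"
    by (simp add: numeral_fps_const algebra_simps)
  have **: "(3 :: rat fps) = fps_const 3" "(2 :: rat fps) = fps_const 2"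
    by (simp_all add: numeral_fps_const)
  have "fps_nth (fps_X * fps_exp (1::rat)) n = of_nat n / fact n"
    by (cases n) (simp_all add: divide_simps del: of_nat_Suc)
  then show ?thesis
    unfolding * unfolding **
    by (auto simp: fps_X_power_iff diff_divide_distrib add_divide_distrib)
qed

theorem mainTheorem3:
  shows "Abs_fps (\<lambda>n. of_nat (d1_4 n) / fact n) =
      (fps_exp 2 - (2 * fps_X - 2) * fps_exp 1 - 3 - 2 * fps_X - fps_const (1/2) * fps_X ^ 2 :: rat fps)
    \<and> (\<forall>n\<ge>4. int (d1_4 n) = 2 ^ n - 2 * int n + 2)"
proof
  show "Abs_fps (\<lambda>n. of_nat (d1_4 n) / fact n) =
      (fps_exp 2 - (2 * fps_X - 2) * fps_exp 1 - 3 - 2 * fps_X - fps_const (1/2) * fps_X ^ 2 :: rat fps)"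
  proof (rule fps_ext, unfold fps_rhs_nth fps_nth_Abs_fps)
    fix n :: nat
    consider "n = 0" | "n = 1" | "n = 2" | "n \<ge> 3" by linarith
    then show "of_nat (d1_4 n) / fact n = (2 ^ n - 2 * of_nat n + 2 :: rat) / fact n
        - (if n = 0 then 3 else if n = 1 then 2 else if n = 2 then 1 / 2 else 0)"
    proof cases
      case 4
      then have "(of_nat (d1_4 n) :: rat) = of_int (2 ^ n - 2 * int n + 2)"
        by (simp flip: d1_4_eq_int)
      then show ?thesis using 4 by simp
    qed (simp_all add: d1_4_eq)
  qed
  show "\<forall>n\<ge>4. int (d1_4 n) = 2 ^ n - 2 * int n + 2"
    by (simp add: d1_4_eq_int)
qed

end
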